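(* Let $\mathbf{A}$ be a quasicomplemented distributive nearlattice. Then the following are equivalent: (1) $\mathbf{A}$ is Stone; (2) every prime ideal of $A$ is contained in exactly one prime $\alpha$-ideal.
   Context: A distributive nearlattice is a join-semilattice $\langle A,\vee,1\rangle$ with greatest element $1$ in which every principal filter $[a)=\{x\in A\colon a\le x\}$ is a bounded distributive lattice. A filter of $A$ is a subset containing $1$, upward closed, and closed under those binary meets that exist; for filters $F,G$, $F\veebar G$ is the smallest filter containing $F\cup G$. An ideal is a downward closed, $\vee$-closed subset; a prime ideal is a non-empty proper ideal $P$ with $a\wedge b\in P\Rightarrow a\in P$ or $b\in P$ whenever $a\wedge b$ exists. For $a\in A$, $a^{\top}=\{x\in A\colon x\vee a=1\}$ and $a^{\top\top}=\{y\in A\colon y\vee x=1\text{ for all }x\in a^{\top}\}$. An ideal $I$ is an $\alpha$-ideal if for each $a\in A$, $I\cap a^{\top\top}\ne\emptyset$ implies $a\in I$. $\mathbf{A}$ is quasicomplemented if for each $a\in A$ there exists $b\in A$ with $a^{\top\top}=b^{\top}$; $\mathbf{A}$ is Stone if $a^{\top}\veebar a^{\top\top}=A$ for every $a\in A$. *)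

theory Defs
  imports Main
begin

text \<open>Binary infima and suprema relative to a subset \<open>S\<close> of an order;
  with \<open>S = UNIV\<close>, \<open>inf_on\<close> is the partial meet of the whole structure.\<close>

definition (in order) inf_on :: "'a set \<Rightarrow> 'a \<Rightarrow> 'a \<Rightarrow> 'a \<Rightarrow> bool" where
  "inf_on S x y m \<longleftrightarrow> m \<in> S \<and> m \<le> x \<and> m \<le> y \<and> (\<forall>z\<in>S. z \<le> x \<and> z \<le> y \<longrightarrow> z \<le> m)"

definition (in order) sup_on :: "'a set \<Rightarrow> 'a \<Rightarrow> 'a \<Rightarrow> 'a \<Rightarrow> bool" where
  "sup_on S x y j \<longleftrightarrow> j \<in> S \<and> x \<le> j \<and> y \<le> j \<and> (\<forall>z\<in>S. x \<le> z \<and> y \<le> z \<longrightarrow> j \<le> z)"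

text \<open>The last conjunct is \<open>x \<and> (y \<or> z) = (x \<and> y) \<or> (x \<and> z)\<close>, with the operations computed in \<open>S\<close>.\<close>

definition (in order) bounded_distributive_lattice_on :: "'a set \<Rightarrow> bool" where
  "bounded_distributive_lattice_on S \<longleftrightarrow>
     (\<exists>b\<in>S. \<forall>x\<in>S. b \<le> x) \<and> (\<exists>t\<in>S. \<forall>x\<in>S. x \<le> t) \<and>
     (\<forall>x\<in>S. \<forall>y\<in>S. (\<exists>m. inf_on S x y m) \<and> (\<exists>j. sup_on S x y j)) \<and>
     (\<forall>x\<in>S. \<forall>y\<in>S. \<forall>z\<in>S. \<forall>j m m1 m2.
        sup_on S y z j \<and> inf_on S x j m \<and> inf_on S x y m1 \<and> inf_on S x z m2
          \<longrightarrow> sup_on S m1 m2 m)"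

class distributive_nearlattice = semilattice_sup + order_top +
  assumes principal_filter_distributive: "bounded_distributive_lattice_on {a..}"

definition nl_filter :: "'a::distributive_nearlattice set \<Rightarrow> bool" where
  "nl_filter F \<longleftrightarrow> top \<in> F \<and> (\<forall>x\<in>F. \<forall>y. x \<le> y \<longrightarrow> y \<in> F) \<and>
     (\<forall>x\<in>F. \<forall>y\<in>F. \<forall>m. inf_on UNIV x y m \<longrightarrow> m \<in> F)"

definition filter_join :: "'a::distributive_nearlattice set \<Rightarrow> 'a set \<Rightarrow> 'a set" where
  "filter_join F G = \<Inter>{H. nl_filter H \<and> F \<union> G \<subseteq> H}"

lemma filter_join_smallest:
  shows "nl_filter (filter_join F G)"
    and "F \<union> G \<subseteq> filter_join F G"
    and "nl_filter H \<Longrightarrow> F \<union> G \<subseteq> H \<Longrightarrow> filter_join F G \<subseteq> H"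
proof -
  have mem: "x \<in> filter_join F G \<longleftrightarrow> (\<forall>H. nl_filter H \<longrightarrow> F \<union> G \<subseteq> H \<longrightarrow> x \<in> H)" for x
    by (auto simp: filter_join_def)
  have up: "y \<in> filter_join F G" if "x \<in> filter_join F G" "x \<le> y" for x y
    unfolding mem
  proof (intro allI impI)
    fix H assume H: "nl_filter H" "F \<union> G \<subseteq> H"
    then have "x \<in> H" using that(1) mem by blast
    with H(1) that(2) show "y \<in> H" unfolding nl_filter_def by blast
  qed
  have meet: "m \<in> filter_join F G"
    if "x \<in> filter_join F G" "y \<in> filter_join F G" "inf_on UNIV x y m" for x y m
    unfolding mem
  proof (intro allI impI)
    fix H assume H: "nl_filter H" "F \<union> G \<subseteq> H"
    then have "x \<in> H" "y \<in> H" using that(1,2) mem by blast+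
    with H(1) that(3) show "m \<in> H" unfolding nl_filter_def by blast
  qed
  have "top \<in> filter_join F G" by (simp add: mem nl_filter_def)
  with up meet show "nl_filter (filter_join F G)" unfolding nl_filter_def by blast
qed (auto simp: filter_join_def)

definition nl_ideal :: "'a::distributive_nearlattice set \<Rightarrow> bool" where
  "nl_ideal I \<longleftrightarrow> (\<forall>x\<in>I. \<forall>y. y \<le> x \<longrightarrow> y \<in> I) \<and> (\<forall>x\<in>I. \<forall>y\<in>I. sup x y \<in> I)"

definition nl_prime_ideal :: "'a::distributive_nearlattice set \<Rightarrow> bool" where
  "nl_prime_ideal P \<longleftrightarrow> nl_ideal P \<and> P \<noteq> {} \<and> P \<noteq> UNIV \<and>
     (\<forall>a b m. inf_on UNIV a b m \<and> m \<in> P \<longrightarrow> a \<in> P \<or> b \<in> P)"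

definition annihilator :: "'a::distributive_nearlattice \<Rightarrow> 'a set" where
  "annihilator a = {x. sup x a = top}"

definition double_annihilator :: "'a::distributive_nearlattice \<Rightarrow> 'a set" where
  "double_annihilator a = {y. \<forall>x\<in>annihilator a. sup y x = top}"

definition alpha_ideal :: "'a::distributive_nearlattice set \<Rightarrow> bool" where
  "alpha_ideal I \<longleftrightarrow> nl_ideal I \<and> (\<forall>a. I \<inter> double_annihilator a \<noteq> {} \<longrightarrow> a \<in> I)"

definition quasicomplemented :: "'a::distributive_nearlattice itself \<Rightarrow> bool" where
  "quasicomplemented _ \<longleftrightarrow> (\<forall>a::'a. \<exists>b. double_annihilator a = annihilator b)"

definition stone :: "'a::distributive_nearlattice itself \<Rightarrow> bool" where
  "stone _ \<longleftrightarrow> (\<forall>a::'a. filter_join (annihilator a) (double_annihilator a) = UNIV)"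

end

theory Submission
  imports Defs
begin

text \<open>
  Since complements of prime ideals are filters, and every point outside a filter can be separated
  from it by a prime ideal, \<open>A\<close> is Stone iff every prime ideal meets \<open>a\<^sup>\<top>\<close> or \<open>a\<^sup>\<top>\<^sup>\<top>\<close>,
  for every \<open>a\<close>.

  Ideals that are maximal among those avoiding \<open>1\<close> are prime \<open>\<alpha>\<close>-ideals, so \<open>P\<close>
  and \<open>a\<close> lie in a common prime \<open>\<alpha>\<close>-ideal iff \<open>P\<close> misses \<open>a\<^sup>\<top>\<close>. If \<open>P\<close> misses both \<open>a\<^sup>\<top>\<close> and
  \<open>a\<^sup>\<top>\<^sup>\<top> = b\<^sup>\<top>\<close>, then there are prime \<open>\<alpha>\<close>-ideals above \<open>P\<close> containing \<open>a\<close> and \<open>b\<close>,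
  respectively; they differ because \<open>a \<or> b = 1\<close>. Conversely, if \<open>P\<close> meets \<open>a\<^sup>\<top>\<close> then no prime \<open>\<alpha>\<close>-ideal
  above \<open>P\<close> contains \<open>a\<close>, and if \<open>P\<close> meets \<open>a\<^sup>\<top>\<^sup>\<top>\<close> then all of them do.
\<close>

lemma inf_on_commute: "inf_on S x y m \<longleftrightarrow> inf_on S y x m"
  unfolding inf_on_def by auto

lemma inf_on_UNIV_absorb: "y \<le> x \<Longrightarrow> inf_on UNIV x y y"
  unfolding inf_on_def by simp

lemma inf_on_atLeast_iff:
  fixes p x y :: "'a::semilattice_sup"
  assumes "p \<le> x" "p \<le> y"
  shows "inf_on {p..} x y m \<longleftrightarrow> inf_on UNIV x y m"
proof
  assume m: "inf_on {p..} x y m"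
  have "z \<le> m" if "z \<le> x" "z \<le> y" for z
  proof -
    have "sup z p \<in> {p..}" "sup z p \<le> x" "sup z p \<le> y" using that assms by simp_all
    then have "sup z p \<le> m" using m unfolding inf_on_def by blast
    then show ?thesis by simp
  qed
  with m show "inf_on UNIV x y m" by (simp add: inf_on_def)
qed (use assms in \<open>auto simp: inf_on_def\<close>)

lemma sup_on_atLeast_iff:
  fixes p x y :: "'a::semilattice_sup"
  assumes "p \<le> x"
  shows "sup_on {p..} x y j \<longleftrightarrow> j = sup x y"
  using assms by (auto simp: sup_on_def le_supI1 intro!: antisym)

lemma inf_on_exists:
  fixes p x y :: "'a::distributive_nearlattice"
  assumes "p \<le> x" "p \<le> y"
  obtains m where "inf_on UNIV x y m"
proof -
  have "\<exists>m. inf_on {p..} x y m"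
    using principal_filter_distributive[of p] assms
    by (simp add: bounded_distributive_lattice_on_def)
  then show ?thesis using that assms by (auto simp: inf_on_atLeast_iff)
qed

lemma inf_on_sup_distrib_bounded:
  fixes p x y z :: "'a::distributive_nearlattice"
  assumes ge: "p \<le> x" "p \<le> y" "p \<le> z"
    and k: "inf_on UNIV x y k" and l: "inf_on UNIV x z l"
  shows "inf_on UNIV x (sup y z) (sup k l)"
proof -
  have "p \<le> sup y z" using ge by (simp add: le_supI1)
  then obtain m where m: "inf_on UNIV x (sup y z) m" using inf_on_exists ge(1) by blast
  have distrib: "\<forall>x\<in>{p..}. \<forall>y\<in>{p..}. \<forall>z\<in>{p..}. \<forall>j m k l.
      sup_on {p..} y z j \<and> inf_on {p..} x j m \<and> inf_on {p..} x y k \<and> inf_on {p..} x z l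
        \<longrightarrow> sup_on {p..} k l m"
    using principal_filter_distributive[of p]
    unfolding bounded_distributive_lattice_on_def by (elim conjE)
  have "sup_on {p..} y z (sup y z)" "inf_on {p..} x (sup y z) m"
    "inf_on {p..} x y k" "inf_on {p..} x z l"
    using ge \<open>p \<le> sup y z\<close> k l m by (simp_all add: sup_on_atLeast_iff inf_on_atLeast_iff)
  then have "sup_on {p..} k l m" using distrib ge by (meson atLeast_iff)
  moreover have "p \<le> k" using k ge by (simp add: inf_on_def)
  ultimately show ?thesis using m by (simp add: sup_on_atLeast_iff)
qed

text \<open>The elements need not have a common lower bound: distributivity is used in \<open>[k)\<close> and \<open>[l)\<close>.\<close>

lemma inf_on_sup_distrib:
  fixes x y z :: "'a::distributive_nearlattice"
  assumes k: "inf_on UNIV x y k" and l: "inf_on UNIV x z l"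
  shows "inf_on UNIV x (sup y z) (sup k l)"
proof -
  have le: "k \<le> x" "k \<le> y" "l \<le> x" "l \<le> z" using k l by (simp_all add: inf_on_def)
  have absorb: "inf_on UNIV x (sup k l) (sup k l)" using le by (simp add: inf_on_UNIV_absorb)
  have "inf_on UNIV x (sup z (sup k l)) (sup l (sup k l))"
    by (rule inf_on_sup_distrib_bounded[OF le(3,4) sup_ge2 l absorb])
  moreover have "sup z (sup k l) = sup k z"
    using le by (metis sup.absorb1 sup.commute sup.left_commute)
  moreover have "sup l (sup k l) = sup k l" by (simp add: sup.absorb2)
  ultimately have "inf_on UNIV x (sup k z) (sup k l)" by simp
  with k have "inf_on UNIV x (sup y (sup k z)) (sup k (sup k l))"
    by (rule inf_on_sup_distrib_bounded[OF le(1,2) sup_ge1])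
  moreover have "sup y (sup k z) = sup y z" using le by (simp add: sup.absorb1 flip: sup.assoc)
  ultimately show ?thesis by simp
qed

lemma sup_inf_on_distrib:
  fixes a b p :: "'a::distributive_nearlattice"
  assumes m: "inf_on UNIV a b m"
  shows "inf_on UNIV (sup p a) (sup p b) (sup p m)"
proof -
  define q where "q = sup p m"
  have le: "m \<le> a" "m \<le> b" "m \<le> q" using m by (simp_all add: inf_on_def q_def)
  obtain n where n: "inf_on UNIV b q n" using inf_on_exists le by blast
  have "inf_on UNIV b (sup q a) (sup n m)"
    using n m by (intro inf_on_sup_distrib) (simp_all add: inf_on_commute)
  then have "inf_on UNIV (sup q a) b (sup n m)" by (simp add: inf_on_commute)
  then have "inf_on UNIV (sup q a) (sup q b) (sup q (sup n m))"
    by (intro inf_on_sup_distrib inf_on_UNIV_absorb) simp_all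
  moreover have "sup q (sup n m) = q" using n le by (simp add: inf_on_def sup.absorb1)
  moreover have "sup q a = sup p a" "sup q b = sup p b"
    using le by (simp_all add: q_def sup.assoc sup.absorb2)
  ultimately show ?thesis by (simp add: q_def)
qed

lemma nl_filter_upward: "nl_filter F \<Longrightarrow> x \<in> F \<Longrightarrow> x \<le> y \<Longrightarrow> y \<in> F"
  unfolding nl_filter_def by blast

lemma nl_filter_inf: "nl_filter F \<Longrightarrow> x \<in> F \<Longrightarrow> y \<in> F \<Longrightarrow> inf_on UNIV x y m \<Longrightarrow> m \<in> F"
  unfolding nl_filter_def by blast

lemma nl_filter_singleton_top: "nl_filter {top :: 'a::distributive_nearlattice}"
  unfolding nl_filter_def inf_on_def by (auto simp: top_le)

lemma nl_ideal_downward: "nl_ideal I \<Longrightarrow> x \<in> I \<Longrightarrow> y \<le> x \<Longrightarrow> y \<in> I"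
  unfolding nl_ideal_def by blast

lemma nl_ideal_sup: "nl_ideal I \<Longrightarrow> x \<in> I \<Longrightarrow> y \<in> I \<Longrightarrow> sup x y \<in> I"
  unfolding nl_ideal_def by blast

lemma nl_ideal_atMost: "nl_ideal {..p :: 'a::distributive_nearlattice}"
  unfolding nl_ideal_def by auto

lemma nl_ideal_Union_chain:
  assumes chain: "subset.chain S C" and ideals: "\<And>I. I \<in> C \<Longrightarrow> nl_ideal I"
  shows "nl_ideal (\<Union>C)"
  unfolding nl_ideal_def
proof (intro conjI ballI allI impI)
  fix x y assume "x \<in> \<Union>C" "y \<le> x"
  then show "y \<in> \<Union>C" using ideals nl_ideal_downward by blast
next
  fix x y assume "x \<in> \<Union>C" "y \<in> \<Union>C"
  then obtain I where I: "I \<in> C" "{x, y} \<subseteq> I"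
    using finite_subset_Union_chain[of "{x, y}" C S] chain by auto
  then have "sup x y \<in> I" using nl_ideal_sup[OF ideals[OF I(1)]] by simp
  then show "sup x y \<in> \<Union>C" using I(1) by blast
qed

lemma nl_prime_idealD:
  assumes "nl_prime_ideal P"
  shows "nl_ideal P" and "P \<noteq> {}" and "top \<notin> P"
proof -
  show ideal: "nl_ideal P" and "P \<noteq> {}" using assms unfolding nl_prime_ideal_def by blast+
  have "P \<noteq> UNIV" using assms unfolding nl_prime_ideal_def by blast
  then show "top \<notin> P" using nl_ideal_downward[OF ideal, of top] by auto
qed

lemma nl_filter_Compl_prime_ideal: "nl_prime_ideal P \<Longrightarrow> nl_filter (- P)"
  using nl_prime_idealD(3)[of P]
  unfolding nl_filter_def nl_prime_ideal_def nl_ideal_def by blast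

definition ideal_adjoin :: "'a::distributive_nearlattice set \<Rightarrow> 'a \<Rightarrow> 'a set" where
  "ideal_adjoin I a = {x. \<exists>p\<in>I. x \<le> sup p a}"

lemma nl_ideal_adjoin:
  assumes "nl_ideal I"
  shows "nl_ideal (ideal_adjoin I a)"
  unfolding nl_ideal_def
proof (intro conjI ballI allI impI)
  fix x y assume "x \<in> ideal_adjoin I a" "y \<le> x"
  then show "y \<in> ideal_adjoin I a" unfolding ideal_adjoin_def by (auto intro: order_trans)
next
  fix x y assume "x \<in> ideal_adjoin I a" "y \<in> ideal_adjoin I a"
  then obtain p q where pq: "p \<in> I" "q \<in> I" and le: "x \<le> sup p a" "y \<le> sup q a"
    unfolding ideal_adjoin_def by auto
  have "sup x y \<le> sup (sup p a) (sup q a)" using le by (rule sup_mono)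
  also have "\<dots> = sup (sup p q) a" by (simp add: ac_simps)
  finally show "sup x y \<in> ideal_adjoin I a"
    using nl_ideal_sup[OF assms pq] unfolding ideal_adjoin_def by blast
qed

lemma subset_ideal_adjoin: "I \<subseteq> ideal_adjoin I a"
  unfolding ideal_adjoin_def by (auto intro: sup_ge1)

lemma mem_ideal_adjoin: "I \<noteq> {} \<Longrightarrow> a \<in> ideal_adjoin I a"
  unfolding ideal_adjoin_def by auto

lemma top_mem_ideal_adjoin_iff: "top \<in> ideal_adjoin I a \<longleftrightarrow> I \<inter> annihilator a \<noteq> {}"
  unfolding ideal_adjoin_def annihilator_def by (auto simp: top_unique)

definition maximal_ideal_avoiding :: "'a::distributive_nearlattice set \<Rightarrow> 'a set \<Rightarrow> bool" where
  "maximal_ideal_avoiding F M \<longleftrightarrow> nl_ideal M \<and> M \<noteq> {} \<and> M \<inter> F = {} \<and>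
     (\<forall>J. nl_ideal J \<and> J \<inter> F = {} \<and> M \<subseteq> J \<longrightarrow> J = M)"

lemma maximal_ideal_avoidingD:
  assumes "maximal_ideal_avoiding F M"
  shows "nl_ideal M" and "M \<noteq> {}" and "M \<inter> F = {}"
    and "nl_ideal J \<Longrightarrow> J \<inter> F = {} \<Longrightarrow> M \<subseteq> J \<Longrightarrow> J = M"
  using assms unfolding maximal_ideal_avoiding_def by simp_all

lemma maximal_ideal_avoiding_exists:
  assumes I: "nl_ideal I" "I \<noteq> {}" "I \<inter> F = {}"
  obtains M where "maximal_ideal_avoiding F M" "I \<subseteq> M"
proof -
  define S where "S = {J. nl_ideal J \<and> I \<subseteq> J \<and> J \<inter> F = {}}"
  have "\<exists>M\<in>S. \<forall>J\<in>S. M \<subseteq> J \<longrightarrow> J = M"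
  proof (rule subset_Zorn_nonempty)
    show "S \<noteq> {}" using I unfolding S_def by auto
  next
    fix C assume "C \<noteq> {}" and chain: "subset.chain S C"
    have members: "J \<in> S" if "J \<in> C" for J
      using chain that unfolding subset.chain_def by blast
    have "nl_ideal (\<Union>C)"
      using chain by (rule nl_ideal_Union_chain) (use members S_def in auto)
    then show "\<Union>C \<in> S" using \<open>C \<noteq> {}\<close> members unfolding S_def by blast
  qed
  then obtain M where "M \<in> S" and maximal: "\<And>J. J \<in> S \<Longrightarrow> M \<subseteq> J \<Longrightarrow> J = M" by blast
  then have M: "nl_ideal M" "I \<subseteq> M" "M \<inter> F = {}" unfolding S_def by auto
  have "J = M" if "nl_ideal J" "J \<inter> F = {}" "M \<subseteq> J" for J
    using maximal that M(2) unfolding S_def by simp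
  then have "maximal_ideal_avoiding F M"
    using M I(2) unfolding maximal_ideal_avoiding_def by auto
  then show thesis using M(2) by (rule that)
qed

lemma maximal_ideal_avoiding_sup_mem:
  assumes M: "maximal_ideal_avoiding F M" and F: "nl_filter F" and a: "a \<notin> M"
  obtains p where "p \<in> M" "sup p a \<in> F"
proof -
  have "ideal_adjoin M a \<noteq> M"
    using mem_ideal_adjoin[OF maximal_ideal_avoidingD(2)[OF M]] a by blast
  then have "ideal_adjoin M a \<inter> F \<noteq> {}"
    using maximal_ideal_avoidingD(1,4)[OF M] nl_ideal_adjoin subset_ideal_adjoin by metis
  then obtain x p where "x \<in> F" "p \<in> M" "x \<le> sup p a" unfolding ideal_adjoin_def by blast
  then show thesis using nl_filter_upward[OF F] that by blast
qed

lemma maximal_ideal_avoiding_prime: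
  assumes M: "maximal_ideal_avoiding F M" and F: "nl_filter F"
  shows "nl_prime_ideal M"
proof -
  note ideal = maximal_ideal_avoidingD(1)[OF M] and disjoint = maximal_ideal_avoidingD(3)[OF M]
  have "a \<in> M \<or> b \<in> M" if m: "inf_on UNIV a b m" "m \<in> M" for a b m
  proof (rule ccontr)
    assume "\<not> (a \<in> M \<or> b \<in> M)"
    then obtain p q where pq: "p \<in> M" "sup p a \<in> F" "q \<in> M" "sup q b \<in> F"
      using maximal_ideal_avoiding_sup_mem[OF M F] by metis
    define r where "r = sup p q"
    have "sup r a \<in> F" "sup r b \<in> F"
      using nl_filter_upward[OF F] pq(2,4) by (auto simp: r_def le_supI1 sup.coboundedI1)
    then have "sup r m \<in> F" using nl_filter_inf[OF F] sup_inf_on_distrib[OF m(1)] by blast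
    moreover have "sup r m \<in> M" using pq(1,3) m(2) by (simp add: r_def nl_ideal_sup[OF ideal])
    ultimately show False using disjoint by blast
  qed
  moreover have "M \<noteq> UNIV" using disjoint F unfolding nl_filter_def by blast
  ultimately show ?thesis
    using ideal maximal_ideal_avoidingD(2)[OF M] unfolding nl_prime_ideal_def by blast
qed

lemma prime_ideal_separation:
  assumes "nl_ideal I" "I \<noteq> {}" "nl_filter F" "I \<inter> F = {}"
  obtains P where "nl_prime_ideal P" "I \<subseteq> P" "P \<inter> F = {}"
proof -
  obtain M where M: "maximal_ideal_avoiding F M" "I \<subseteq> M"
    using maximal_ideal_avoiding_exists assms by blast
  show thesis
    using maximal_ideal_avoiding_prime[OF M(1) assms(3)] M(2) maximal_ideal_avoidingD(3)[OF M(1)]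
    by (rule that)
qed

lemma filter_join_eq_UNIV_iff:
  fixes F G :: "'a::distributive_nearlattice set"
  shows "filter_join F G = UNIV \<longleftrightarrow>
    (\<forall>P. nl_prime_ideal P \<longrightarrow> P \<inter> F \<noteq> {} \<or> P \<inter> G \<noteq> {})"
proof (intro iffI allI impI)
  fix P :: "'a set" assume join: "filter_join F G = UNIV" and P: "nl_prime_ideal P"
  have "- P \<noteq> UNIV" using nl_prime_idealD(2)[OF P] by blast
  then have "\<not> F \<union> G \<subseteq> - P"
    using filter_join_smallest(3)[OF nl_filter_Compl_prime_ideal[OF P], of F G] join by auto
  then show "P \<inter> F \<noteq> {} \<or> P \<inter> G \<noteq> {}" by blast
next
  assume meets: "\<forall>P. nl_prime_ideal P \<longrightarrow> P \<inter> F \<noteq> {} \<or> P \<inter> G \<noteq> {}"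
  show "filter_join F G = UNIV"
  proof (rule ccontr)
    assume "filter_join F G \<noteq> UNIV"
    then obtain p where "p \<notin> filter_join F G" by blast
    then have disjoint: "{..p} \<inter> filter_join F G = {}"
      using nl_filter_upward[OF filter_join_smallest(1)] by blast
    obtain P where "nl_prime_ideal P" "P \<inter> filter_join F G = {}"
      by (rule prime_ideal_separation[OF nl_ideal_atMost _ filter_join_smallest(1) disjoint]) auto
    then show False using meets filter_join_smallest(2)[of F G] by blast
  qed
qed

definition meets_annihilators :: "'a::distributive_nearlattice set \<Rightarrow> bool" where
  "meets_annihilators P \<longleftrightarrow>
     (\<forall>a. P \<inter> annihilator a \<noteq> {} \<or> P \<inter> double_annihilator a \<noteq> {})"

lemma stone_iff_prime_ideals_meet_annihilators:
  "stone TYPE('a::distributive_nearlattice) \<longleftrightarrow>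
     (\<forall>P :: 'a set. nl_prime_ideal P \<longrightarrow> meets_annihilators P)"
  unfolding stone_def filter_join_eq_UNIV_iff meets_annihilators_def by blast

lemma mem_double_annihilator_self: "a \<in> double_annihilator a"
  unfolding double_annihilator_def annihilator_def by (simp add: sup_commute)

lemma nl_ideal_disjoint_annihilator:
  assumes "nl_ideal I" "top \<notin> I" "a \<in> I"
  shows "I \<inter> annihilator a = {}"
  using nl_ideal_sup[OF assms(1) _ assms(3)] assms(2) unfolding annihilator_def by force

lemma maximal_ideal_avoiding_top_alpha:
  assumes M: "maximal_ideal_avoiding {top} M"
  shows "alpha_ideal M"
proof -
  have ideal: "nl_ideal M" and "top \<notin> M" using maximal_ideal_avoidingD(1,3)[OF M] by auto
  have "a \<in> M" if y: "y \<in> M" "y \<in> double_annihilator a" for a y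
  proof (rule ccontr)
    assume "a \<notin> M"
    then obtain p where "p \<in> M" "p \<in> annihilator a"
      by (rule maximal_ideal_avoiding_sup_mem[OF M nl_filter_singleton_top])
        (simp add: annihilator_def)
    moreover from this have "p \<in> annihilator y"
      using y(2) unfolding double_annihilator_def annihilator_def by (simp add: sup_commute)
    ultimately show False using nl_ideal_disjoint_annihilator[OF ideal \<open>top \<notin> M\<close> y(1)] by blast
  qed
  then show ?thesis using ideal unfolding alpha_ideal_def by blast
qed

lemma prime_alpha_ideal_containing:
  assumes I: "nl_ideal I" "I \<noteq> {}" "I \<inter> annihilator a = {}"
  obtains Q where "nl_prime_ideal Q" "alpha_ideal Q" "I \<subseteq> Q" "a \<in> Q"
proof -
  have "ideal_adjoin I a \<inter> {top} = {}" using I(3) top_mem_ideal_adjoin_iff[of I a] by blast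
  then obtain M where M: "maximal_ideal_avoiding {top} M" "ideal_adjoin I a \<subseteq> M"
    using maximal_ideal_avoiding_exists[OF nl_ideal_adjoin[OF I(1)]] mem_ideal_adjoin[OF I(2)]
    by blast
  show thesis
  proof (rule that)
    show "nl_prime_ideal M"
      using M(1) nl_filter_singleton_top by (rule maximal_ideal_avoiding_prime)
    show "alpha_ideal M" using M(1) by (rule maximal_ideal_avoiding_top_alpha)
    show "I \<subseteq> M" "a \<in> M" using M(2) subset_ideal_adjoin mem_ideal_adjoin[OF I(2)] by blast+
  qed
qed

lemma prime_alpha_ideal_subset:
  assumes meets: "meets_annihilators P"
    and Q: "nl_prime_ideal Q" "P \<subseteq> Q" and R: "alpha_ideal R" "P \<subseteq> R"
  shows "Q \<subseteq> R"
proof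
  fix a assume "a \<in> Q"
  with nl_prime_idealD(1,3)[OF Q(1)] have "Q \<inter> annihilator a = {}"
    by (rule nl_ideal_disjoint_annihilator)
  then have "P \<inter> double_annihilator a \<noteq> {}"
    using meets Q(2) unfolding meets_annihilators_def by blast
  then show "a \<in> R" using R unfolding alpha_ideal_def by blast
qed

lemma distinct_prime_alpha_ideals:
  assumes P: "nl_ideal P" "P \<noteq> {}"
    and disjoint: "P \<inter> annihilator a = {}" "P \<inter> annihilator b = {}"
    and join: "sup a b = top"
  obtains Q R where "nl_prime_ideal Q" "alpha_ideal Q" "P \<subseteq> Q"
    and "nl_prime_ideal R" "alpha_ideal R" "P \<subseteq> R" and "Q \<noteq> R"
proof -
  obtain Q where Q: "nl_prime_ideal Q" "alpha_ideal Q" "P \<subseteq> Q" "a \<in> Q"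
    using prime_alpha_ideal_containing[OF P disjoint(1)] by blast
  obtain R where R: "nl_prime_ideal R" "alpha_ideal R" "P \<subseteq> R" "b \<in> R"
    using prime_alpha_ideal_containing[OF P disjoint(2)] by blast
  have "b \<notin> Q"
    using nl_ideal_sup[OF nl_prime_idealD(1)[OF Q(1)] Q(4)] nl_prime_idealD(3)[OF Q(1)] join
    by metis
  then show thesis using that[OF Q(1-3) R(1-3)] R(4) by blast
qed

lemma unique_prime_alpha_ideal_iff:
  fixes P :: "'a::distributive_nearlattice set"
  assumes quasicomplemented: "quasicomplemented TYPE('a)" and P: "nl_prime_ideal P"
  shows "(\<exists>!Q. nl_prime_ideal Q \<and> alpha_ideal Q \<and> P \<subseteq> Q) \<longleftrightarrow> meets_annihilators P"
proof
  assume unique: "\<exists>!Q. nl_prime_ideal Q \<and> alpha_ideal Q \<and> P \<subseteq> Q"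
  show "meets_annihilators P"
    unfolding meets_annihilators_def
  proof (intro allI, rule ccontr)
    fix a :: 'a
    obtain b where b: "double_annihilator a = annihilator b"
      using quasicomplemented unfolding quasicomplemented_def by blast
    have "sup a b = top" using mem_double_annihilator_self[of a] unfolding b annihilator_def by simp
    moreover assume "\<not> (P \<inter> annihilator a \<noteq> {} \<or> P \<inter> double_annihilator a \<noteq> {})"
    then have "P \<inter> annihilator a = {}" "P \<inter> annihilator b = {}" unfolding b by simp_all
    ultimately show False
      using distinct_prime_alpha_ideals[OF nl_prime_idealD(1,2)[OF P]] unique by metis
  qed
next
  assume meets: "meets_annihilators P"
  obtain a where "a \<in> P" using nl_prime_idealD(2)[OF P] by blast
  with nl_prime_idealD(1,3)[OF P] have "P \<inter> annihilator a = {}"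
    by (rule nl_ideal_disjoint_annihilator)
  then obtain Q where "nl_prime_ideal Q" "alpha_ideal Q" "P \<subseteq> Q"
    using prime_alpha_ideal_containing nl_prime_idealD(1,2)[OF P] by blast
  then show "\<exists>!Q. nl_prime_ideal Q \<and> alpha_ideal Q \<and> P \<subseteq> Q"
    using prime_alpha_ideal_subset[OF meets] by blast
qed

theorem theorem4p10:
  assumes "quasicomplemented TYPE('a::distributive_nearlattice)"
  shows "stone TYPE('a) \<longleftrightarrow>
    (\<forall>P :: 'a set. nl_prime_ideal P \<longrightarrow>
       (\<exists>!Q. nl_prime_ideal Q \<and> alpha_ideal Q \<and> P \<subseteq> Q))"
proof -
  have "stone TYPE('a) \<longleftrightarrow> (\<forall>P :: 'a set. nl_prime_ideal P \<longrightarrow> meets_annihilators P)"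
    by (rule stone_iff_prime_ideals_meet_annihilators)
  also have "\<dots> \<longleftrightarrow> (\<forall>P :: 'a set. nl_prime_ideal P \<longrightarrow>
      (\<exists>!Q. nl_prime_ideal Q \<and> alpha_ideal Q \<and> P \<subseteq> Q))"
    by (intro iff_allI imp_cong refl unique_prime_alpha_ideal_iff[OF assms, symmetric])
  finally show ?thesis .
qed

end
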